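(* Let $\lambda_1,\lambda_2$ be real numbers such that none of the hypergeometric denominators below vanishes. Let $b_n,c_n,d_n$ be the multiple Charlier recurrence coefficients (with parameters $\lambda_1,\lambda_2$) given in the context, and let $T_m$ be the corresponding tetradiagonal matrices. Put $z=\lambda_1-\lambda_2$ and for $n\ge0$ set $$a_{6n+1}=\lambda_1,\qquad a_{6n+4}=\lambda_2,$$ $$a_{6n+2}=\frac{(n)_n(\lambda_2-\lambda_1)}{(n+1)_n}\cdot\frac{{}_1F_1\left[{-n\atop -2n+1};z\right]}{{}_1F_1\left[{-n\atop -2n};z\right]},\qquad a_{6n+5}=\frac{(n+1)(\lambda_1-\lambda_2)}{2n+1}\cdot\frac{{}_1F_1\left[{-n\atop -2n};z\right]}{{}_1F_1\left[{-n-1\atop -2n-1};z\right]},$$ $$a_{6n+3}=(2n+1)\frac{{}_1F_1\left[{-n-1\atop -2n-1};z\right]}{{}_1F_1\left[{-n\atop -2n};z\right]},\qquad a_{6n+6}=2(n+1)\frac{{}_1F_1\left[{-n-1\atop -2n-2};z\right]}{{}_1F_1\left[{-n-1\atop -2n-1};z\right]}.$$ Then for every $m\ge1$ one has the bidiagonal factorization $T_m=L_{1,m}L_{2,m}U_m$, with $L_{1,m},L_{2,m},U_m$ built from these $a_n$ as in the context.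
   Context: Matrices. Given sequences $(b_n)_{n\ge0},(c_n)_{n\ge1},(d_n)_{n\ge2}$, $T_m$ is the $m\times m$ matrix (rows and columns numbered from $1$) with $(T_m)_{i,i}=b_{i-1}$, $(T_m)_{i,i+1}=1$, $(T_m)_{i+1,i}=c_i$, $(T_m)_{i+2,i}=d_{i+1}$ and all other entries $0$. Given $(a_n)_{n\ge1}$: $L_{1,m}$ is the $m\times m$ lower bidiagonal matrix with $1$'s on the diagonal and $(L_{1,m})_{i+1,i}=a_{3i-1}$; $L_{2,m}$ is lower bidiagonal with $1$'s on the diagonal and $(L_{2,m})_{i+1,i}=a_{3i}$; $U_m$ is upper bidiagonal with diagonal entries $(U_m)_{i,i}=a_{3i-2}$ and $1$'s on the superdiagonal. Notation. $(x)_k=x(x+1)\cdots(x+k-1)$, $(x)_0=1$ (in particular $(0)_0=1$). For a nonnegative integer $p$, ${}_1F_1\left[{-p\atop u};z\right]=\sum_{j=0}^{p}\frac{(-p)_j}{(u)_j\,j!}z^j$ (terms $j>p$ are discarded even if $u$ is a nonpositive integer). Recurrence coefficients (multiple Charlier), $k\ge0$: $b_{2k}=2k+\lambda_1$; $b_{2k+1}=2k+1+\lambda_2$; $c_{2k}=k(\lambda_1+\lambda_2)$; $c_{2k+1}=(k+1)\lambda_1+k\lambda_2$; $d_{2k}=k\lambda_1(\lambda_1-\lambda_2)$; $d_{2k+1}=k\lambda_2(\lambda_2-\lambda_1)$. *)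

theory Defs
  imports Complex_Main "Jordan_Normal_Form.Matrix"
begin

text \<open>
  Rows and columns of \<open>mat m m\<close> are numbered from 0, so position \<open>(i, j)\<close> below is
  position \<open>(i + 1, j + 1)\<close> in the customary numbering from 1. The sequences keep their
  customary indices: \<open>b\<close> starts at 0, \<open>c\<close> and \<open>a\<close> at 1, and \<open>d\<close> at 2; earlier values
  do not enter the matrices.
\<close>

definition tetradiag_T ::
  "(nat \<Rightarrow> real) \<Rightarrow> (nat \<Rightarrow> real) \<Rightarrow> (nat \<Rightarrow> real) \<Rightarrow> nat \<Rightarrow> real mat" where
  "tetradiag_T b c d m = mat m m (\<lambda>(i, j).
     if j = i then b i
     else if j = i + 1 then 1
     else if i = j + 1 then c (j + 1)
     else if i = j + 2 then d (j + 2)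
     else 0)"

definition bidiag_L1 :: "(nat \<Rightarrow> real) \<Rightarrow> nat \<Rightarrow> real mat" where
  "bidiag_L1 a m = mat m m (\<lambda>(i, j).
     if j = i then 1 else if i = j + 1 then a (3 * j + 2) else 0)"

definition bidiag_L2 :: "(nat \<Rightarrow> real) \<Rightarrow> nat \<Rightarrow> real mat" where
  "bidiag_L2 a m = mat m m (\<lambda>(i, j).
     if j = i then 1 else if i = j + 1 then a (3 * j + 3) else 0)"

definition bidiag_U :: "(nat \<Rightarrow> real) \<Rightarrow> nat \<Rightarrow> real mat" where
  "bidiag_U a m = mat m m (\<lambda>(i, j).
     if j = i then a (3 * i + 1) else if j = i + 1 then 1 else 0)"

text \<open>
  The terminating series \<open>1F1[-p; u; z]\<close>, with summation cut off at \<open>j = p\<close> also when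
  \<open>u\<close> is a nonpositive integer.
\<close>

definition hyp1F1_poly :: "nat \<Rightarrow> real \<Rightarrow> real \<Rightarrow> real" where
  "hyp1F1_poly p u z =
     (\<Sum>j\<le>p. pochhammer (- real p) j / (pochhammer u j * fact j) * z ^ j)"

text \<open>
  Recurrence coefficients of the multiple Charlier polynomials. The index \<open>n\<close> is \<open>2k\<close> or
  \<open>2k + 1\<close>, so \<open>k = n div 2\<close>; the lemmas give the formulas in terms of \<open>k\<close>.
\<close>

definition charlier_b :: "real \<Rightarrow> real \<Rightarrow> nat \<Rightarrow> real" where
  "charlier_b l1 l2 n = (if even n then real n + l1 else real n + l2)"

definition charlier_c :: "real \<Rightarrow> real \<Rightarrow> nat \<Rightarrow> real" where
  "charlier_c l1 l2 n = (let k = real (n div 2) in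
     if even n then k * (l1 + l2) else (k + 1) * l1 + k * l2)"

definition charlier_d :: "real \<Rightarrow> real \<Rightarrow> nat \<Rightarrow> real" where
  "charlier_d l1 l2 n = (let k = real (n div 2) in
     if even n then k * l1 * (l1 - l2) else k * l2 * (l2 - l1))"

lemma charlier_b_even: "charlier_b l1 l2 (2 * k) = 2 * real k + l1"
  and charlier_b_odd: "charlier_b l1 l2 (2 * k + 1) = 2 * real k + 1 + l2"
  and charlier_c_even: "charlier_c l1 l2 (2 * k) = real k * (l1 + l2)"
  and charlier_c_odd: "charlier_c l1 l2 (2 * k + 1) = (real k + 1) * l1 + real k * l2"
  and charlier_d_even: "charlier_d l1 l2 (2 * k) = real k * l1 * (l1 - l2)"
  and charlier_d_odd: "charlier_d l1 l2 (2 * k + 1) = real k * l2 * (l2 - l1)"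
  by (simp_all add: charlier_b_def charlier_c_def charlier_d_def Let_def)

end

theory Submission
  imports Defs
begin

text \<open>
  Write \<open>E n = 1F1[-n; -2n; z]\<close> and \<open>P n = 1F1[-n; -2n+1; z]\<close>. Entrywise, the factorization says
  \<open>b (i+1) = a (3i+2) + a (3i+3) + a (3i+4)\<close>, together with similar expressions for \<open>c\<close> and \<open>d\<close>.
  The conditions on \<open>b\<close> amount to the contiguous relations
  \<open>P (n+1) = E (n+1) + z E n / (2 (2n+1))\<close> and \<open>P (n+1) = E n + z P n / (2 (2n+1))\<close>, where in
  the second one \<open>P 0\<close> has to be read as \<open>2\<close>: the prefactor \<open>(n)_n / (n+1)_n\<close> in
  \<open>a (6n+2)\<close> is \<open>1\<close> for \<open>n = 0\<close> and \<open>1/2\<close> otherwise. Given these, the quotients of \<open>E\<close> and \<open>P\<close> cancel in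
  all products of the \<open>a\<close>'s occurring in \<open>c\<close> and \<open>d\<close>.
\<close>

section \<open>Entries of products of bidiagonal matrices\<close>

lemma sum_lessThan_lower_bidiag:
  fixes f g :: "nat \<Rightarrow> real"
  assumes "i < m"
  shows "(\<Sum>k<m. (if k = i then 1 else if i = k + 1 then f k else 0) * g k)
    = g i + (case i of 0 \<Rightarrow> 0 | Suc k \<Rightarrow> f k * g k)"
proof -
  have "(\<Sum>k<m. (if k = i then 1 else if i = k + 1 then f k else 0) * g k)
    = (\<Sum>k<m. if k = i then g k else 0) + (\<Sum>k<m. if i = k + 1 then f k * g k else 0)"
    by (subst sum.distrib[symmetric], rule sum.cong) auto
  moreover have "(\<Sum>k<m. if k = i then g k else 0) = g i"
    using assms by simp
  moreover have "(\<Sum>k<m. if i = k + 1 then f k * g k else 0)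
    = (case i of 0 \<Rightarrow> 0 | Suc k \<Rightarrow> f k * g k)"
    using assms by (cases i) simp_all
  ultimately show ?thesis by simp
qed

lemma index_lower_bidiag_mult:
  fixes f :: "nat \<Rightarrow> real"
  assumes "i < m" "j < m" "A \<in> carrier_mat m m"
  shows "(mat m m (\<lambda>(i, j). if j = i then 1 else if i = j + 1 then f j else 0) * A) $$ (i, j)
    = A $$ (i, j) + (case i of 0 \<Rightarrow> 0 | Suc k \<Rightarrow> f k * A $$ (k, j))"
  using sum_lessThan_lower_bidiag[OF assms(1), of f "\<lambda>k. A $$ (k, j)"] assms
  by (simp add: scalar_prod_def atLeast0LessThan)

text \<open>Bracketed to the right, the product arises from \<open>bidiag_U a m\<close> by two row
  operations, each adding to every row a multiple of the row above it. Hence only rows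
  \<open>i\<close>, \<open>i - 1\<close> and \<open>i - 2\<close> of the last factor contribute to
  row \<open>i\<close>, and truncation at size \<open>m\<close> causes no boundary terms. The
  entries \<open>b 0\<close> and \<open>c 1\<close> are treated separately because rows 0 and 1 have
  fewer than two rows above them.\<close>

lemma tetradiag_eq_bidiag_mult:
  assumes b0: "b 0 = a 1"
    and b: "\<And>i. b (i + 1) = a (3 * i + 2) + a (3 * i + 3) + a (3 * i + 4)"
    and c1: "c 1 = (a 2 + a 3) * a 1"
    and c: "\<And>i. c (i + 2) = (a (3 * i + 5) + a (3 * i + 6)) * a (3 * i + 4)
      + a (3 * i + 5) * a (3 * i + 3)"
    and d: "\<And>i. d (i + 2) = a (3 * i + 5) * a (3 * i + 3) * a (3 * i + 1)"
  shows "tetradiag_T b c d m = bidiag_L1 a m * bidiag_L2 a m * bidiag_U a m"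
proof -
  have carr: "bidiag_L1 a m \<in> carrier_mat m m" "bidiag_L2 a m \<in> carrier_mat m m"
    "bidiag_U a m \<in> carrier_mat m m"
    by (simp_all add: bidiag_L1_def bidiag_L2_def bidiag_U_def)
  have "tetradiag_T b c d m = bidiag_L1 a m * (bidiag_L2 a m * bidiag_U a m)"
  proof (rule eq_matI)
    fix i j
    assume "i < dim_row (bidiag_L1 a m * (bidiag_L2 a m * bidiag_U a m))"
      and "j < dim_col (bidiag_L1 a m * (bidiag_L2 a m * bidiag_U a m))"
    then have i: "i < m" and j: "j < m"
      using carr by auto
    define u where "u i = (if j = i then a (3 * i + 1) else if j = i + 1 then 1 else 0)" for i
    have U: "bidiag_U a m $$ (k, j) = u k" if "k < m" for k
      using that j by (simp add: bidiag_U_def u_def)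
    have L2U: "(bidiag_L2 a m * bidiag_U a m) $$ (k, j)
      = u k + (case k of 0 \<Rightarrow> 0 | Suc l \<Rightarrow> a (3 * l + 3) * u l)" if "k < m" for k
      using index_lower_bidiag_mult[OF that j carr(3), of "\<lambda>j. a (3 * j + 3)"] that
      unfolding bidiag_L2_def by (simp add: U split: nat.split)
    have "(bidiag_L1 a m * (bidiag_L2 a m * bidiag_U a m)) $$ (i, j)
      = u i + (case i of 0 \<Rightarrow> 0 | Suc l \<Rightarrow> a (3 * l + 3) * u l)
        + (case i of 0 \<Rightarrow> 0 | Suc k \<Rightarrow> a (3 * k + 2)
            * (u k + (case k of 0 \<Rightarrow> 0 | Suc l \<Rightarrow> a (3 * l + 3) * u l)))"
      using index_lower_bidiag_mult[OF i j mult_carrier_mat[OF carr(2,3)],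
          of "\<lambda>j. a (3 * j + 2)"] i
      unfolding bidiag_L1_def[symmetric] by (simp add: L2U split: nat.split)
    also have "\<dots> = tetradiag_T b c d m $$ (i, j)"
    proof -
      consider "i = 0" | "i = 1" | k where "i = Suc (Suc k)"
        by (metis One_nat_def not0_implies_Suc)
      then show ?thesis
      proof cases
        case 1
        then show ?thesis
          using b0 i j by (simp add: tetradiag_T_def u_def)
      next
        case 2
        then show ?thesis
          using b[of 0] c1 i j
          by (simp add: tetradiag_T_def u_def numeral_eq_Suc algebra_simps)
      next
        case (3 k)
        then show ?thesis
          using b[of "Suc k"] c[of k] d[of k] i j
          by (auto simp: tetradiag_T_def u_def numeral_eq_Suc algebra_simps)
      qed
    qed
    finally show "tetradiag_T b c d m $$ (i, j)
      = (bidiag_L1 a m * (bidiag_L2 a m * bidiag_U a m)) $$ (i, j)" by simp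
  qed (use carr in \<open>auto simp: tetradiag_T_def\<close>)
  then show ?thesis
    using assoc_mult_mat[OF carr] by simp
qed

section \<open>Contiguous relations for the truncated series\<close>

lemma hyp1F1_poly_Suc:
  "hyp1F1_poly (Suc p) u z = 1 + (\<Sum>i\<le>p. pochhammer (- real p - 1) (Suc i)
      / (pochhammer u (Suc i) * fact (Suc i)) * z ^ Suc i)"
  unfolding hyp1F1_poly_def by (subst sum.atMost_Suc_shift) (simp add: minus_diff_commute)

text \<open>The added term \<open>i = p\<close> vanishes because
  \<open>pochhammer (- real p) (Suc p) = 0\<close>. It makes the summation range agree with that of
  a series of upper parameter \<open>- p\<close> multiplied by \<open>z\<close>.\<close>

lemma hyp1F1_poly_shift:
  "hyp1F1_poly p u z = 1 + (\<Sum>i\<le>p. pochhammer (- real p) (Suc i)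
      / (pochhammer u (Suc i) * fact (Suc i)) * z ^ Suc i)"
proof -
  have "hyp1F1_poly p u z = (\<Sum>i\<le>Suc p. pochhammer (- real p) i
      / (pochhammer u i * fact i) * z ^ i)"
    by (simp add: hyp1F1_poly_def pochhammer_of_nat_eq_0_lemma)
  then show ?thesis
    by (simp add: sum.atMost_Suc_shift del: sum.atMost_Suc)
qed

text \<open>Compare coefficients of \<open>z ^ Suc i\<close>. Subtracting the reciprocals of
  \<open>pochhammer u (Suc i)\<close> and \<open>pochhammer (u - 1) (Suc i)\<close> produces the
  numerator \<open>(u - 1) - (u + i) = - (i + 1)\<close>, which reduces \<open>fact (Suc i)\<close>
  to \<open>fact i\<close> and leaves a coefficient of the series with lower parameter
  \<open>u + 1\<close>.\<close>

lemma hyp1F1_poly_contiguous_lower: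
  assumes nz: "pochhammer (u - 1) (p + 2) \<noteq> 0"
  shows "hyp1F1_poly (Suc p) u z = hyp1F1_poly (Suc p) (u - 1) z
    + (real p + 1) / ((u - 1) * u) * z * hyp1F1_poly p (u + 1) z"
proof -
  have "pochhammer (- real p - 1) (Suc i) / (pochhammer u (Suc i) * fact (Suc i)) * z ^ Suc i
    = pochhammer (- real p - 1) (Suc i) / (pochhammer (u - 1) (Suc i) * fact (Suc i)) * z ^ Suc i
      + (real p + 1) / ((u - 1) * u) * z
        * (pochhammer (- real p) i / (pochhammer (u + 1) i * fact i) * z ^ i)"
    if "i \<le> p" for i
  proof -
    \<comment> \<open>A zero factor persists in every longer Pochhammer symbol, so \<open>nz\<close>
      passes down to all orders up to \<open>p + 2\<close>; the factorizations below then isolate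
      each denominator.\<close>
    have "pochhammer (u - 1) (Suc (Suc i)) \<noteq> 0"
      using nz that by (metis Suc_le_mono add_2_eq_Suc' pochhammer_eq_0_mono)
    moreover have "pochhammer (u - 1) (Suc (Suc i)) = (u - 1) * u * pochhammer (u + 1) i"
      by (simp add: pochhammer_rec)
    moreover have Y: "u * pochhammer (u + 1) i = pochhammer u i * (u + i)"
      using pochhammer_rec[of u i] pochhammer_rec'[of u i] by (simp add: mult.commute)
    ultimately have nz': "u - 1 \<noteq> 0" "u \<noteq> 0" "pochhammer (u + 1) i \<noteq> 0"
      "pochhammer u i \<noteq> 0" "u + i \<noteq> 0"
      by auto
    \<comment> \<open>With everything expressed through \<open>pochhammer (- real p) i\<close> and
      \<open>pochhammer u i\<close>, an identity of rational functions remains.\<close>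
    have eqs: "pochhammer (- real p - 1) (Suc i) = (- real p - 1) * pochhammer (- real p) i"
      "pochhammer u (Suc i) = pochhammer u i * (u + i)"
      "pochhammer (u - 1) (Suc i) = (u - 1) * pochhammer u i"
      "pochhammer (u + 1) i = pochhammer u i * (u + i) / u"
      using pochhammer_rec'[of u i] Y nz' by (simp_all add: pochhammer_rec field_simps)
    show ?thesis
      unfolding eqs using nz' by (simp add: divide_simps) (simp add: algebra_simps)
  qed
  then show ?thesis
    unfolding hyp1F1_poly_Suc[of p u] hyp1F1_poly_Suc[of p "u - 1"] hyp1F1_poly_def[of p "u + 1"]
    by (simp add: sum.distrib sum_distrib_left)
qed

text \<open>Again by coefficients: the decisive identity is \<open>(- p - 1) * (u + i) - (i - p) *
  (u - 1) = - (i + 1) * (p + u)\<close>, whose factor \<open>i + 1\<close> is absorbed by the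
  factorial.\<close>

lemma hyp1F1_poly_contiguous_both:
  assumes nz: "pochhammer (u - 1) (p + 2) \<noteq> 0"
  shows "hyp1F1_poly (Suc p) (u - 1) z = hyp1F1_poly p u z
    - (real p + u) / ((u - 1) * u) * z * hyp1F1_poly p (u + 1) z"
proof -
  have "pochhammer (- real p - 1) (Suc i) / (pochhammer (u - 1) (Suc i) * fact (Suc i)) * z ^ Suc i
    = pochhammer (- real p) (Suc i) / (pochhammer u (Suc i) * fact (Suc i)) * z ^ Suc i
      - (real p + u) / ((u - 1) * u) * z
        * (pochhammer (- real p) i / (pochhammer (u + 1) i * fact i) * z ^ i)"
    if "i \<le> p" for i
  proof -
    have "pochhammer (u - 1) (Suc (Suc i)) \<noteq> 0"
      using nz that by (metis Suc_le_mono add_2_eq_Suc' pochhammer_eq_0_mono)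
    moreover have "pochhammer (u - 1) (Suc (Suc i)) = (u - 1) * u * pochhammer (u + 1) i"
      by (simp add: pochhammer_rec)
    moreover have Y: "u * pochhammer (u + 1) i = pochhammer u i * (u + i)"
      using pochhammer_rec[of u i] pochhammer_rec'[of u i] by (simp add: mult.commute)
    ultimately have nz': "u - 1 \<noteq> 0" "u \<noteq> 0" "pochhammer (u + 1) i \<noteq> 0"
      "pochhammer u i \<noteq> 0" "u + i \<noteq> 0"
      by auto
    have eqs: "pochhammer (- real p - 1) (Suc i) = (- real p - 1) * pochhammer (- real p) i"
      "pochhammer (- real p) (Suc i) = pochhammer (- real p) i * (real i - real p)"
      "pochhammer u (Suc i) = pochhammer u i * (u + i)"
      "pochhammer (u - 1) (Suc i) = (u - 1) * pochhammer u i"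
      "pochhammer (u + 1) i = pochhammer u i * (u + i) / u"
      using pochhammer_rec'[of u i] pochhammer_rec'[of "- real p" i] Y nz'
      by (simp_all add: pochhammer_rec field_simps)
    show ?thesis
      unfolding eqs using nz' by (simp add: divide_simps) (simp add: algebra_simps)
  qed
  then show ?thesis
    unfolding hyp1F1_poly_Suc[of p "u - 1"] hyp1F1_poly_shift[of p u] hyp1F1_poly_def[of p "u + 1"]
    by (simp add: sum_subtractf sum_distrib_left)
qed

text \<open>The case \<open>p = n\<close>, \<open>u = - 2 * real n - 1\<close>. The factors in the
  nonvanishing condition run from \<open>-2n-2\<close> to \<open>-n-1\<close>, so it holds for every
  \<open>n\<close>.\<close>

lemma hyp1F1_odd_eq_even:
  "hyp1F1_poly (n + 1) (- 2 * real n - 1) z = hyp1F1_poly (n + 1) (- 2 * real n - 2) z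
    + z / (2 * (2 * real n + 1)) * hyp1F1_poly n (- 2 * real n) z"
proof -
  have "pochhammer (- 2 * real n - 1 - 1) (n + 2) \<noteq> 0"
    by (auto simp: pochhammer_eq_0_iff)
  note hyp1F1_poly_contiguous_lower[OF this, of z]
  moreover have "(real n + 1) / ((- 2 * real n - 1 - 1) * (- 2 * real n - 1))
    = 1 / (2 * (2 * real n + 1))"
    by (simp add: divide_simps) (simp add: algebra_simps)
  moreover have "- 2 * real n - 1 - 1 = - 2 * real n - 2" "- 2 * real n - 1 + 1 = - 2 * real n"
    by simp_all
  ultimately show ?thesis
    by (metis Suc_eq_plus1 mult.left_neutral times_divide_eq_left)
qed

text \<open>The case \<open>p = n\<close>, \<open>u = - 2 * real n\<close>. Here the factors run
  from \<open>-2n-1\<close> to \<open>-n\<close>, which excludes \<open>n = 0\<close>; for positive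
  \<open>n\<close> the coefficient \<open>n / (2n (2n+1))\<close> reduces to the same one as in the
  previous relation.\<close>

lemma hyp1F1_odd_eq_even':
  assumes "n > 0"
  shows "hyp1F1_poly (n + 1) (- 2 * real n - 1) z = hyp1F1_poly n (- 2 * real n) z
    + z / (2 * (2 * real n + 1)) * hyp1F1_poly n (- 2 * real n + 1) z"
proof -
  have "pochhammer (- 2 * real n - 1) (n + 2) \<noteq> 0"
    using assms by (auto simp: pochhammer_eq_0_iff)
  note hyp1F1_poly_contiguous_both[OF this, of z]
  moreover have "(real n + - 2 * real n) / ((- 2 * real n - 1) * (- 2 * real n))
    = - 1 / (2 * (2 * real n + 1))"
    using assms by (simp add: divide_simps)
  ultimately show ?thesis by simp
qed

section \<open>The multiple Charlier coefficients\<close>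

lemma pochhammer_ratio:
  assumes "n > 0"
  shows "pochhammer (real n) n / pochhammer (real n + 1) n = 1 / 2"
proof -
  \<comment> \<open>Both sides are \<open>pochhammer (real n) (n + 1)\<close>, with the first or the
    last factor split off.\<close>
  have "real n * pochhammer (real n + 1) n = 2 * real n * pochhammer (real n) n"
    using pochhammer_rec[of "real n" n] pochhammer_rec'[of "real n" n] by auto
  moreover have "pochhammer (real n + 1) n > 0"
    by (rule pochhammer_pos) simp
  ultimately show ?thesis
    using assms by (simp add: field_simps)
qed

theorem proposition3p8:
  fixes l1 l2 z :: real and a :: "nat \<Rightarrow> real" and m :: nat
  assumes z: "z = l1 - l2"
    and nonzero_even: "\<And>n. hyp1F1_poly n (- 2 * real n) z \<noteq> 0"
    and nonzero_odd: "\<And>n. hyp1F1_poly (n + 1) (- 2 * real n - 1) z \<noteq> 0"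
    and a1: "\<And>n. a (6 * n + 1) = l1"
    and a4: "\<And>n. a (6 * n + 4) = l2"
    and a2: "\<And>n. a (6 * n + 2) =
      pochhammer (real n) n * (l2 - l1) / pochhammer (real n + 1) n *
      (hyp1F1_poly n (- 2 * real n + 1) z / hyp1F1_poly n (- 2 * real n) z)"
    and a5: "\<And>n. a (6 * n + 5) =
      (real n + 1) * (l1 - l2) / (2 * real n + 1) *
      (hyp1F1_poly n (- 2 * real n) z / hyp1F1_poly (n + 1) (- 2 * real n - 1) z)"
    and a3: "\<And>n. a (6 * n + 3) =
      (2 * real n + 1) *
      (hyp1F1_poly (n + 1) (- 2 * real n - 1) z / hyp1F1_poly n (- 2 * real n) z)"
    and a6: "\<And>n. a (6 * n + 6) =
      2 * (real n + 1) *
      (hyp1F1_poly (n + 1) (- 2 * real n - 2) z / hyp1F1_poly (n + 1) (- 2 * real n - 1) z)"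
    and m: "m \<ge> 1"
  shows "tetradiag_T (charlier_b l1 l2) (charlier_c l1 l2) (charlier_d l1 l2) m =
    bidiag_L1 a m * bidiag_L2 a m * bidiag_U a m"
proof -
  define E where "E n = hyp1F1_poly n (- 2 * real n) z" for n
  define P where "P n = (if n = 0 then 2 else hyp1F1_poly n (- 2 * real n + 1) z)" for n
  have P_Suc: "hyp1F1_poly (n + 1) (- 2 * real n - 1) z = P (n + 1)" for n
    by (simp add: P_def minus_diff_commute)
  have E_Suc: "hyp1F1_poly (n + 1) (- 2 * real n - 2) z = E (n + 1)" for n
    by (simp add: E_def minus_diff_commute)
  have E0: "E n \<noteq> 0" for n
    using nonzero_even by (simp add: E_def)
  have P0: "P n \<noteq> 0" for n
    using nonzero_odd[of "n - 1"] by (cases n) (simp_all add: P_def minus_diff_commute)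
  have P_rec1: "P (n + 1) = E (n + 1) + z / (2 * (2 * real n + 1)) * E n" for n
    using hyp1F1_odd_eq_even[of n z] unfolding P_Suc E_Suc E_def[symmetric] .
  have P_rec2: "P (n + 1) = E n + z / (2 * (2 * real n + 1)) * P n" for n
  proof (cases "n = 0")
    case True
    then show ?thesis
      \<comment> \<open>Here \<open>P 1 = 1 + z\<close> and \<open>E 0 = 1\<close>, so the relation
        holds precisely because \<open>P 0 = 2\<close>.\<close>
      by (simp add: P_def E_def hyp1F1_poly_def)
  next
    case False
    then show ?thesis
      using hyp1F1_odd_eq_even'[of n z] unfolding P_Suc E_def[symmetric] by (simp add: P_def)
  qed
  have A2: "a (6 * n + 2) = - z / 2 * (P n / E n)" for n
  proof (cases "n = 0")
    case True
    then show ?thesis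
      using a2[of 0] z by (simp add: P_def E_def hyp1F1_poly_def)
  next
    case False
    then have "pochhammer (real n) n / pochhammer (real n + 1) n * (l2 - l1) = - z / 2"
      unfolding z by (subst pochhammer_ratio) simp_all
    then show ?thesis
      using a2[of n] False unfolding times_divide_eq_left[symmetric] by (simp add: P_def E_def)
  qed
  have A3: "a (6 * n + 3) = (2 * real n + 1) * (P (n + 1) / E n)" for n
    using a3[of n] unfolding P_Suc E_def .
  have A5: "a (6 * n + 5) = (real n + 1) * z / (2 * real n + 1) * (E n / P (n + 1))" for n
    using a5[of n] unfolding P_Suc E_def z[symmetric] .
  have A6: "a (6 * n + 6) = 2 * (real n + 1) * (E (n + 1) / P (n + 1))" for n
    using a6[of n] unfolding P_Suc E_Suc .
  have cancel: "r * (x + z / (2 * r) * y) = r * x + z / 2 * y" if "r \<noteq> 0" for r x y :: real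
    using that by (simp add: field_simps)
  have nz: "2 * real n + 1 \<noteq> 0" for n
    by simp
  \<comment> \<open>This is the part of \<open>charlier_b l1 l2 (2 * n + 1)\<close> free of
    \<open>l2\<close>; the second contiguous relation, multiplied by \<open>2 * real n + 1\<close>,
    gives it.\<close>
  have A23: "a (6 * n + 2) + a (6 * n + 3) = 2 * real n + 1" for n
  proof -
    have "(2 * real n + 1) * P (n + 1) = (2 * real n + 1) * E n + z / 2 * P n"
      unfolding P_rec2 by (rule cancel[OF nz])
    then have "a (6 * n + 3) = ((2 * real n + 1) * E n + z / 2 * P n) / E n"
      unfolding A3 by simp
    then show ?thesis
      unfolding A2 using E0[of n] by (simp add: add_divide_distrib)
  qed
  have A56: "a (6 * n + 5) + a (6 * n + 6) = 2 * (real n + 1)" for n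
  proof -
    \<comment> \<open>Solving the first contiguous relation for \<open>E (n + 1)\<close> turns
      \<open>a (6 * n + 6)\<close> into \<open>2 * (real n + 1)\<close> minus exactly
      \<open>a (6 * n + 5)\<close>.\<close>
    have E: "E (n + 1) = P (n + 1) - z / (2 * (2 * real n + 1)) * E n"
      using P_rec1[of n] by simp
    have "a (6 * n + 6) = 2 * (real n + 1)
      - (real n + 1) * z / (2 * real n + 1) * (E n / P (n + 1))"
      unfolding A6 E using P0[of "n + 1"] nz[of n]
      by (simp add: divide_simps) (simp add: algebra_simps)
    then show ?thesis
      unfolding A5 by simp
  qed
  have A35: "a (6 * n + 5) * a (6 * n + 3) = (real n + 1) * z" for n
    unfolding A3 A5 using E0[of n] P0[of "n + 1"] nz[of n] by simp
  have A68: "a (6 * n + 8) * a (6 * n + 6) = - (real n + 1) * z" for n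
  proof -
    \<comment> \<open>The index is \<open>6 * (n + 1) + 2\<close>, so this factor belongs to the
      next block of six and carries \<open>P (n + 1)\<close>, which cancels against
      \<open>a (6 * n + 6)\<close>.\<close>
    have "a (6 * n + 8) = - z / 2 * (P (n + 1) / E (n + 1))"
      using A2[of "n + 1"] by (simp add: add.commute)
    then show ?thesis
      unfolding A6 using E0[of "n + 1"] P0[of "n + 1"] by simp (simp add: field_simps)
  qed
  \<comment> \<open>The sequence \<open>a\<close> is given in blocks of six while a matrix row
    advances the index by three, so the parity of \<open>i\<close> decides which half of a block
    occurs.\<close>
  have parity: "\<exists>n. i = 2 * n \<or> i = 2 * n + 1" for i :: nat
    by presburger
  show ?thesis
  proof (rule tetradiag_eq_bidiag_mult)
    show "charlier_b l1 l2 0 = a 1"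
      using a1[of 0] by (simp add: charlier_b_def)
    show "charlier_c l1 l2 1 = (a 2 + a 3) * a 1"
      using a1[of 0] A23[of 0] by (simp add: charlier_c_def numeral_2_eq_2)
  next
    fix i :: nat
    obtain n where "i = 2 * n \<or> i = 2 * n + 1"
      using parity by blast
    then show "charlier_b l1 l2 (i + 1) = a (3 * i + 2) + a (3 * i + 3) + a (3 * i + 4)"
    proof
      assume i: "i = 2 * n"
      show ?thesis
        using A23[of n] a4[of n] by (simp add: i charlier_b_def algebra_simps)
    next
      assume i: "i = 2 * n + 1"
      show ?thesis
        using A56[of n] a1[of "n + 1"] by (simp add: i charlier_b_def algebra_simps)
    qed
  next
    fix i :: nat
    obtain n where "i = 2 * n \<or> i = 2 * n + 1"
      using parity by blast
    then show "charlier_c l1 l2 (i + 2) = (a (3 * i + 5) + a (3 * i + 6)) * a (3 * i + 4)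
      + a (3 * i + 5) * a (3 * i + 3)"
    proof
      assume i: "i = 2 * n"
      show ?thesis
        using A56[of n] A35[of n] a4[of n] charlier_c_even[of l1 l2 "n + 1"]
        by (simp add: i z algebra_simps)
    next
      \<comment> \<open>The indices \<open>3 * i + 4\<close>, \<open>3 * i + 5\<close>,
        \<open>3 * i + 6\<close> lie in block \<open>n + 1\<close>, but
        \<open>3 * i + 3 = 6 * n + 6\<close> still lies in block \<open>n\<close>. The value is
        \<open>(2n+3) l1 - (n+1) (l1 - l2)\<close>.\<close>
      assume i: "i = 2 * n + 1"
      show ?thesis
        using A23[of "n + 1"] A68[of n] a1[of "n + 1"] charlier_c_odd[of l1 l2 "n + 1"]
        by (simp add: i z algebra_simps)
    qed
  next
    fix i :: nat
    obtain n where "i = 2 * n \<or> i = 2 * n + 1"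
      using parity by blast
    then show "charlier_d l1 l2 (i + 2) = a (3 * i + 5) * a (3 * i + 3) * a (3 * i + 1)"
    proof
      assume i: "i = 2 * n"
      have "a (3 * i + 5) * a (3 * i + 3) * a (3 * i + 1) = (real n + 1) * z * l1"
        using A35[of n] a1[of n] by (simp add: i)
      then show ?thesis
        using charlier_d_even[of l1 l2 "n + 1"] by (simp add: i z)
    next
      assume i: "i = 2 * n + 1"
      have "a (3 * i + 5) * a (3 * i + 3) * a (3 * i + 1) = - (real n + 1) * z * l2"
        using A68[of n] a4[of n] by (simp add: i add.commute)
      then show ?thesis
        using charlier_d_odd[of l1 l2 "n + 1"] by (simp add: i z algebra_simps)
    qed
  qed
qed

end
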